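(* For all positive integers $a\ge b\ge c$ with $(a,b,c)\notin\{(1,1,1),(2,1,1),(3,1,1)\}$ we have $\chi_3([a,b,c])\ge 6$.
   Context: For positive integers $p,q,r$ let $\mathcal{CC}_1([p,q,r])=\{[x,x+p]\times[y,y+q]\times[z,z+r]: x,y,z\in\mathbb{Z}\}$, and let $\mathcal{CC}_3([a,b,c])$ be the union of $\mathcal{CC}_1([p,q,r])$ over all permutations $(p,q,r)$ of $(a,b,c)$ (congruent cuboids, arbitrary axis-parallel orientation). A configuration is a finite subset of $\mathcal{CC}_3([a,b,c])$ with pairwise disjoint interiors; two of its cuboids touch if their intersection is a non-degenerate two-dimensional rectangle; its contact graph has the cuboids as vertices and edges between touching cuboids. $\chi_3([a,b,c])$ is the maximum chromatic number of such a contact graph over all configurations; note it depends only on the multiset $\{a,b,c\}$. *)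

theory Defs
  imports "HOL-Analysis.Analysis" "HOL-Library.Multiset"
begin

definition CC1 :: "nat \<Rightarrow> nat \<Rightarrow> nat \<Rightarrow> (real \<times> real \<times> real) set set" where
  "CC1 p q r =
     {{of_int x .. of_int x + of_nat p} \<times> {of_int y .. of_int y + of_nat q}
        \<times> {of_int z .. of_int z + of_nat r} | x y z :: int. True}"

definition CC3 :: "nat \<Rightarrow> nat \<Rightarrow> nat \<Rightarrow> (real \<times> real \<times> real) set set" where
  "CC3 a b c = \<Union>{CC1 p q r | p q r. {#p, q, r#} = {#a, b, c#}}"

definition configuration :: "nat \<Rightarrow> nat \<Rightarrow> nat \<Rightarrow> (real \<times> real \<times> real) set set \<Rightarrow> bool" where
  "configuration a b c V \<longleftrightarrow>
     finite V \<and> V \<subseteq> CC3 a b c \<and>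
     (\<forall>C\<in>V. \<forall>D\<in>V. C \<noteq> D \<longrightarrow> interior C \<inter> interior D = {})"

definition nondegenerate_rectangle :: "(real \<times> real \<times> real) set \<Rightarrow> bool" where
  "nondegenerate_rectangle S \<longleftrightarrow>
     (\<exists>x x' y y' z z'. S = {x..x'} \<times> {y..y'} \<times> {z..z'} \<and>
        (x = x' \<and> y < y' \<and> z < z' \<or>
         x < x' \<and> y = y' \<and> z < z' \<or>
         x < x' \<and> y < y' \<and> z = z'))"

definition touch :: "(real \<times> real \<times> real) set \<Rightarrow> (real \<times> real \<times> real) set \<Rightarrow> bool" where
  "touch C D \<longleftrightarrow> nondegenerate_rectangle (C \<inter> D)"

text \<open>A simple graph is a pair of a vertex set and a set of two-element edges.\<close>

definition contact_graph ::
    "(real \<times> real \<times> real) set set \<Rightarrow>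
     (real \<times> real \<times> real) set set \<times> (real \<times> real \<times> real) set set set" where
  "contact_graph V = (V, {{C, D} | C D. C \<in> V \<and> D \<in> V \<and> C \<noteq> D \<and> touch C D})"

definition proper_colouring :: "'v set \<times> 'v set set \<Rightarrow> nat \<Rightarrow> ('v \<Rightarrow> nat) \<Rightarrow> bool" where
  "proper_colouring G k f \<longleftrightarrow>
     f ` fst G \<subseteq> {..<k} \<and> (\<forall>u v. {u, v} \<in> snd G \<longrightarrow> f u \<noteq> f v)"

definition chromatic_number :: "'v set \<times> 'v set set \<Rightarrow> nat" where
  "chromatic_number G = (LEAST k. \<exists>f. proper_colouring G k f)"

text \<open>\<open>Max\<close> is only meaningful on a finite nonempty set; see \<open>finite_chi3\<close> and
  \<open>nonempty_chi3\<close> below.\<close>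

definition chi3 :: "nat \<Rightarrow> nat \<Rightarrow> nat \<Rightarrow> nat" where
  "chi3 a b c = Max {chromatic_number (contact_graph V) | V. configuration a b c V}"

lemma nonempty_chi3:
  "{chromatic_number (contact_graph V) | V. configuration a b c V} \<noteq> {}"
proof -
  have "configuration a b c {}" by (simp add: configuration_def)
  then show ?thesis by blast
qed

lemma CC3_touch_bound:
  fixes a b c :: nat
  shows "\<exists>k. \<forall>V. V \<subseteq> CC3 a b c \<longrightarrow> (\<exists>f. proper_colouring (contact_graph V) k f)"
proof -
  define n where "n = a + b + c"
  define N where "N = int n + 1"
  define box where "box = (\<lambda>(p::nat, q::nat, r::nat, x::int, y::int, z::int).
    {of_int x .. of_int x + of_nat p :: real} \<times> {of_int y .. of_int y + of_nat q :: real}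
      \<times> {of_int z .. of_int z + of_nat r :: real})"
  define ok where "ok = (\<lambda>C (p::nat, q::nat, r::nat, x::int, y::int, z::int).
    p \<le> n \<and> q \<le> n \<and> r \<le> n \<and> C = box (p, q, r, x, y, z))"
  define red where "red = (\<lambda>(p::nat, q::nat, r::nat, x::int, y::int, z::int).
    (p, q, r, x mod N, y mod N, z mod N))"
  define K where "K = {..n} \<times> {..n} \<times> {..n} \<times> {0..<N} \<times> {0..<N} \<times> {0..<N}"
  have N: "N > 0" by (simp add: N_def)
  have "finite K" by (simp add: K_def)
  then obtain h where h: "bij_betw h K {0..<card K}" using ex_bij_betw_finite_nat by blast
  have ex: "\<exists>t. ok C t" if C: "C \<in> CC3 a b c" for C
  proof -
    obtain p q r x y z where 1: "{#p, q, r#} = {#a, b, c#}" "C = box (p, q, r, x, y, z)"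
      using C by (auto simp: CC3_def CC1_def box_def)
    have "sum_mset {#p, q, r#} = sum_mset {#a, b, c#}" using 1(1) by simp
    then have "p + q + r = n" by (simp add: n_def)
    then have "ok C (p, q, r, x, y, z)" using 1(2) by (auto simp: ok_def)
    then show ?thesis by blast
  qed
  define t where "t = (\<lambda>C. SOME t. ok C t)"
  have t: "ok C (t C)" if "C \<in> CC3 a b c" for C
    unfolding t_def using ex[OF that] by (rule someI_ex)
  have inK: "red (t C) \<in> K" if "C \<in> CC3 a b c" for C
    using t[OF that] N by (auto simp: ok_def red_def K_def split: prod.splits)
  have near: "x = x'" if "x mod N = x' mod N" "s \<le> n"
    "real_of_int x \<le> u" "u \<le> real_of_int x + real s"
    "real_of_int x' \<le> u" "u \<le> real_of_int x' + real s" for x x' s u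
  proof -
    have "\<bar>x - x'\<bar> < N" unfolding N_def using that by linarith
    moreover have "N dvd x - x'" using that(1) by (simp add: mod_eq_dvd_iff)
    ultimately show ?thesis using dvd_imp_le_int[of "x - x'" N] N by fastforce
  qed
  have sep: "C = D" if CD: "C \<in> CC3 a b c" "D \<in> CC3 a b c" "touch C D"
    "red (t C) = red (t D)" for C D
  proof -
    obtain p q r x y z where tC: "t C = (p, q, r, x, y, z)" by (cases "t C") auto
    obtain p' q' r' x' y' z' where tD: "t D = (p', q', r', x', y', z')" by (cases "t D") auto
    have eq: "p' = p" "q' = q" "r' = r"
      "x mod N = x' mod N" "y mod N = y' mod N" "z mod N = z' mod N"
      using CD(4) by (auto simp: red_def tC tD)
    have C: "C = box (p, q, r, x, y, z)" "p \<le> n" "q \<le> n" "r \<le> n"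
      using t[OF CD(1)] by (auto simp: ok_def tC)
    have D: "D = box (p, q, r, x', y', z')"
      using t[OF CD(2)] eq by (auto simp: ok_def tD)
    have "C \<inter> D \<noteq> {}" using CD(3)
      unfolding touch_def nondegenerate_rectangle_def
    by (auto simp: eq_commute[of "{}"])
    then obtain u v w where "(u, v, w) \<in> C" "(u, v, w) \<in> D" by auto
    then have "x = x'" "y = y'" "z = z'"
      using near[OF eq(4) C(2), of u] near[OF eq(5) C(3), of v] near[OF eq(6) C(4), of w]
      unfolding C(1) D box_def by auto
    then show ?thesis using C(1) D by simp
  qed
  have "proper_colouring (contact_graph V) (card K) (\<lambda>C. h (red (t C)))"
    if V: "V \<subseteq> CC3 a b c" for V
  proof -
    have "h (red (t C)) < card K" if "C \<in> V" for C
      using bij_betwE[OF h] inK[of C] that V by auto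
    moreover have "h (red (t C)) \<noteq> h (red (t D))"
      if "C \<in> V" "D \<in> V" "C \<noteq> D" "touch C D" for C D
    proof
      assume "h (red (t C)) = h (red (t D))"
      then have "red (t C) = red (t D)"
        using bij_betw_imp_inj_on[OF h] inK[of C] inK[of D] that V by (auto dest: inj_onD)
      then show False using sep[of C D] that V by auto
    qed
    ultimately show ?thesis
      unfolding proper_colouring_def contact_graph_def
      by (fastforce simp: doubleton_eq_iff)
  qed
  then show ?thesis by blast
qed

lemma finite_chi3:
  "finite {chromatic_number (contact_graph V) | V. configuration a b c V}"
proof -
  obtain k where k: "\<And>V. V \<subseteq> CC3 a b c \<Longrightarrow> \<exists>f. proper_colouring (contact_graph V) k f"
    using CC3_touch_bound[of a b c] by blast
  have "chromatic_number (contact_graph V) \<le> k" if "configuration a b c V" for V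
    unfolding chromatic_number_def
    by (rule Least_le) (use k that in \<open>auto simp: configuration_def\<close>)
  then have "{chromatic_number (contact_graph V) | V. configuration a b c V} \<subseteq> {..k}" by auto
  then show ?thesis by (rule finite_subset) simp
qed

end

theory Submission
  imports Defs
begin

text \<open>
  Whether cuboids overlap or touch depends only on the order of their face coordinates. Hence a
  finite arrangement whose coordinates have the form \<open>i + j * t\<close> with fixed integers \<open>i\<close>, \<open>j\<close>, and
  whose order relations hold for every \<open>t \<ge> 0\<close>, gives a configuration with the same contacts for
  infinitely many side lengths at once. Every admissible triple is covered by one of seven
  arrangements, found by computer search: cubes for \<open>c \<ge> 2\<close>, planks for \<open>c = 1\<close>, \<open>b \<ge> 2\<close>, \<open>a \<ge> 3\<close>,
  slabs for \<open>(2, 2, 1)\<close>, and rods for \<open>b = c = 1\<close> with \<open>a = 4\<close>, \<open>a = 5\<close>, \<open>a = 6\<close> and \<open>a \<ge> 7\<close>.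
  That none of their contact graphs has a proper 5-colouring is a propositional statement, refuted
  by a SAT solver whose proof is replayed.
\<close>

section \<open>Configurations with parametric coordinates\<close>

text \<open>The \<open>LEAST\<close> in \<open>chromatic_number\<close> is attained because
  \<open>CC3_touch_bound\<close> supplies some colouring. A colouring with at most \<open>k\<close>
  colours is also one for \<open>k\<close>, which contradicts \<open>no\<close>, and
  \<open>finite_chi3\<close> makes \<open>Max\<close> an upper bound.\<close>

lemma chi3_ge:
  assumes V: "configuration a b c V"
    and no: "\<And>f. \<not> proper_colouring (contact_graph V) k f"
  shows "chi3 a b c \<ge> Suc k"
proof -
  let ?col = "\<lambda>m. \<exists>f. proper_colouring (contact_graph V) m f"
  have "V \<subseteq> CC3 a b c" using V by (simp add: configuration_def)
  then obtain m where "?col m" using CC3_touch_bound[of a b c] by blast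
  then have "?col (chromatic_number (contact_graph V))"
    unfolding chromatic_number_def by (rule LeastI)
  then obtain f where f: "proper_colouring (contact_graph V) (chromatic_number (contact_graph V)) f"
    by blast
  have "Suc k \<le> chromatic_number (contact_graph V)"
  proof (rule ccontr)
    assume "\<not> Suc k \<le> chromatic_number (contact_graph V)"
    with f have "proper_colouring (contact_graph V) k f"
      by (simp add: proper_colouring_def)
        (meson lessThan_subset_iff nat_le_linear not_less_eq_eq subset_trans)
    with no show False by blast
  qed
  also have "\<dots> \<le> chi3 a b c"
    unfolding chi3_def using V by (intro Max_ge finite_chi3) blast
  finally show ?thesis .
qed

text \<open>The pair \<open>(i, j)\<close> stands for the coordinate \<open>i + j * t\<close>, where \<open>t\<close> is the amount by which the
  true side length exceeds its minimal value; comparisons of pairs hold for all \<open>t\<close> at once.\<close>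

type_synonym coord = "int \<times> int"
type_synonym point = "coord \<times> coord \<times> coord"

datatype box = Box "coord \<times> coord" "coord \<times> coord" "coord \<times> coord"

fun coord_val :: "nat \<Rightarrow> coord \<Rightarrow> int" where
  "coord_val t (i, j) = i + j * int t"

text \<open>The componentwise order is exactly the order of values valid for every natural
  \<open>t\<close>: \<open>t = 0\<close> forces the first comparison and large \<open>t\<close> the
  second. It is partial, so a failed test does not give the reverse inequality.\<close>

fun coord_le :: "coord \<Rightarrow> coord \<Rightarrow> bool" where
  "coord_le (i, j) (i', j') \<longleftrightarrow> i \<le> i' \<and> j \<le> j'"

fun coord_less :: "coord \<Rightarrow> coord \<Rightarrow> bool" where
  "coord_less (i, j) (i', j') \<longleftrightarrow> i < i' \<and> j \<le> j'"

lemma coord_val_mono: "coord_le x y \<Longrightarrow> coord_val t x \<le> coord_val t y"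
  by (cases x; cases y) (auto intro!: add_mono mult_right_mono)

lemma coord_val_strict_mono: "coord_less x y \<Longrightarrow> coord_val t x < coord_val t y"
  by (cases x; cases y) (auto intro!: add_less_le_mono mult_right_mono)

fun apart :: "coord \<times> coord \<Rightarrow> coord \<times> coord \<Rightarrow> bool" where
  "apart (a, b) (c, d) \<longleftrightarrow> coord_le b c \<or> coord_le d a"

text \<open>Equality of pairs, not of values at a single \<open>t\<close>, so that a contact
  persists for every \<open>t\<close>.\<close>

fun abut :: "coord \<times> coord \<Rightarrow> coord \<times> coord \<Rightarrow> bool" where
  "abut (a, b) (c, d) \<longleftrightarrow> b = c \<or> d = a"

fun overlap :: "coord \<times> coord \<Rightarrow> coord \<times> coord \<Rightarrow> bool" where
  "overlap (a, b) (c, d) \<longleftrightarrow> coord_less a d \<and> coord_less c b"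

fun box_apart :: "box \<Rightarrow> box \<Rightarrow> bool" where
  "box_apart (Box x y z) (Box x' y' z') \<longleftrightarrow> apart x x' \<or> apart y y' \<or> apart z z'"

text \<open>Soundness is what matters: a contact that this test misses merely drops a clause, and
  refuting fewer clauses still rules out every 5-colouring.\<close>

fun box_touch :: "box \<Rightarrow> box \<Rightarrow> bool" where
  "box_touch (Box x y z) (Box x' y' z') \<longleftrightarrow>
     abut x x' \<and> overlap y y' \<and> overlap z z' \<or>
     overlap x x' \<and> abut y y' \<and> overlap z z' \<or>
     overlap x x' \<and> overlap y y' \<and> abut z z'"

fun cuboid :: "point \<Rightarrow> point \<Rightarrow> box" where
  "cuboid ((p, p'), (q, q'), (r, r')) ((x, x'), (y, y'), (z, z')) =
     Box ((x, x'), (x + p, x' + p')) ((y, y'), (y + q, y' + q')) ((z, z'), (z + r, z' + r'))"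

text \<open>Each pair consists of a shape and the positions of boxes of that shape.\<close>

primrec boxes :: "(point \<times> point list) list \<Rightarrow> box list" where
  "boxes [] = []"
| "boxes (g # gs) = map (cuboid (fst g)) (snd g) @ boxes gs"

section \<open>Real cuboids obtained from parametric boxes\<close>

definition seg :: "nat \<Rightarrow> coord \<times> coord \<Rightarrow> real set" where
  "seg t I = {of_int (coord_val t (fst I)) .. of_int (coord_val t (snd I))}"

definition proper_seg :: "nat \<Rightarrow> coord \<times> coord \<Rightarrow> bool" where
  "proper_seg t I \<longleftrightarrow> coord_val t (fst I) < coord_val t (snd I)"

text \<open>Each axis has its own parameter, so that lengths along different axes can grow
  independently.\<close>

fun realize :: "nat \<Rightarrow> nat \<Rightarrow> nat \<Rightarrow> box \<Rightarrow> (real \<times> real \<times> real) set" where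
  "realize s t u (Box x y z) = seg s x \<times> seg t y \<times> seg u z"

fun proper_box :: "nat \<Rightarrow> nat \<Rightarrow> nat \<Rightarrow> box \<Rightarrow> bool" where
  "proper_box s t u (Box x y z) \<longleftrightarrow> proper_seg s x \<and> proper_seg t y \<and> proper_seg u z"

lemma interior_seg:
  "interior (seg t I) = {of_int (coord_val t (fst I)) <..< of_int (coord_val t (snd I))}"
  by (simp add: seg_def)

lemma apart_disjoint:
  assumes "apart I J"
  shows "interior (seg t I) \<inter> interior (seg t J) = {}"
proof -
  obtain a b c d where I: "I = (a, b)" "J = (c, d)" by (cases I; cases J)
  have "coord_val t b \<le> coord_val t c \<or> coord_val t d \<le> coord_val t a"
    using assms by (auto simp: I coord_val_mono)
  then show ?thesis by (auto simp: I interior_seg)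
qed

lemma box_apart_disjoint:
  "box_apart B C \<Longrightarrow> interior (realize s t u B) \<inter> interior (realize s t u C) = {}"
  by (cases B; cases C) (auto simp: interior_Times Times_Int_Times dest!: apart_disjoint)

text \<open>Properness puts the two segments on opposite sides of the shared end, so they meet only
  there and cannot be equal. The inequality later shows that touching boxes are distinct
  vertices.\<close>

lemma abut_meet:
  assumes "abut I J" "proper_seg t I" "proper_seg t J"
  shows "\<exists>x. seg t I \<inter> seg t J = {x..x}" "seg t I \<noteq> seg t J"
proof -
  obtain a b c d where I: "I = (a, b)" "J = (c, d)" by (cases I; cases J)
  show "\<exists>x. seg t I \<inter> seg t J = {x..x}"
    using assms by (intro exI[of _ "if b = c then of_int (coord_val t b) else of_int (coord_val t a)"])
      (auto simp: I seg_def proper_seg_def)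
  show "seg t I \<noteq> seg t J"
    using assms by (auto simp: I seg_def proper_seg_def Icc_eq_Icc)
qed

lemma overlap_meet:
  assumes "overlap I J" "proper_seg t I" "proper_seg t J"
  shows "\<exists>x x'. x < x' \<and> seg t I \<inter> seg t J = {x..x'}"
proof -
  obtain a b c d where I: "I = (a, b)" "J = (c, d)" by (cases I; cases J)
  have "coord_val t a < coord_val t d" "coord_val t c < coord_val t b"
    using assms(1) by (auto simp: I coord_val_strict_mono)
  then show ?thesis using assms(2,3)
    by (intro exI[of _ "of_int (max (coord_val t a) (coord_val t c))"]
        exI[of _ "of_int (min (coord_val t b) (coord_val t d))"])
      (auto simp: I seg_def proper_seg_def)
qed

lemma box_touch_touch:
  assumes "box_touch B C" "proper_box s t u B" "proper_box s t u C"
  shows "touch (realize s t u B) (realize s t u C)" "realize s t u B \<noteq> realize s t u C"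
proof -
  obtain x y z where B: "B = Box x y z" by (cases B)
  obtain x' y' z' where C: "C = Box x' y' z'" by (cases C)
  have p: "proper_seg s x" "proper_seg t y" "proper_seg u z"
    "proper_seg s x'" "proper_seg t y'" "proper_seg u z'"
    using assms(2,3) by (auto simp: B C)
  have I: "(X \<times> Y \<times> Z) \<inter> (X' \<times> Y' \<times> Z') = (X \<inter> X') \<times> (Y \<inter> Y') \<times> (Z \<inter> Z')"
    for X X' Y Y' Z Z' :: "real set" by auto
  \<comment> \<open>Products with an empty factor may coincide although other factors differ;
    nonempty factors let a difference along one axis separate the boxes.\<close>
  have ne: "seg s x \<noteq> {}" "seg t y \<noteq> {}" "seg u z \<noteq> {}"
    using p by (auto simp: seg_def proper_seg_def)
  consider (x) "abut x x'" "overlap y y'" "overlap z z'"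
    | (y) "overlap x x'" "abut y y'" "overlap z z'"
    | (z) "overlap x x'" "overlap y y'" "abut z z'"
    using assms(1) by (auto simp: B C)
  then have "touch (realize s t u B) (realize s t u C) \<and> realize s t u B \<noteq> realize s t u C"
  proof cases
    case x
    obtain x1 y1 y2 z1 z2 where "y1 < y2" "z1 < z2" "seg s x \<inter> seg s x' = {x1..x1}"
      "seg t y \<inter> seg t y' = {y1..y2}" "seg u z \<inter> seg u z' = {z1..z2}"
      using x p overlap_meet abut_meet(1) by metis
    then have "touch (realize s t u B) (realize s t u C)"
      unfolding touch_def nondegenerate_rectangle_def B C realize.simps I by blast
    then show ?thesis using abut_meet(2)[OF x(1) p(1,4)] ne by (auto simp: B C times_eq_iff)
  next
    case y
    obtain x1 x2 y1 z1 z2 where "x1 < x2" "z1 < z2" "seg s x \<inter> seg s x' = {x1..x2}"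
      "seg t y \<inter> seg t y' = {y1..y1}" "seg u z \<inter> seg u z' = {z1..z2}"
      using y p overlap_meet abut_meet(1) by metis
    then have "touch (realize s t u B) (realize s t u C)"
      unfolding touch_def nondegenerate_rectangle_def B C realize.simps I by blast
    then show ?thesis using abut_meet(2)[OF y(2) p(2,5)] ne by (auto simp: B C times_eq_iff)
  next
    case z
    obtain x1 x2 y1 y2 z1 where "x1 < x2" "y1 < y2" "seg s x \<inter> seg s x' = {x1..x2}"
      "seg t y \<inter> seg t y' = {y1..y2}" "seg u z \<inter> seg u z' = {z1..z1}"
      using z p overlap_meet abut_meet(1) by metis
    then have "touch (realize s t u B) (realize s t u C)"
      unfolding touch_def nondegenerate_rectangle_def B C realize.simps I by blast
    then show ?thesis using abut_meet(2)[OF z(3) p(3,6)] ne by (auto simp: B C times_eq_iff)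
  qed
  then show "touch (realize s t u B) (realize s t u C)" "realize s t u B \<noteq> realize s t u C"
    by blast+
qed

primrec all_apart :: "box list \<Rightarrow> bool" where
  "all_apart [] \<longleftrightarrow> True"
| "all_apart (B # Bs) \<longleftrightarrow> list_all (box_apart B) Bs \<and> all_apart Bs"

lemma all_apart_disjoint:
  "all_apart Bs \<Longrightarrow> B \<in> set Bs \<Longrightarrow> C \<in> set Bs \<Longrightarrow> B \<noteq> C \<Longrightarrow>
     interior (realize s t u B) \<inter> interior (realize s t u C) = {}"
proof (induction Bs)
  case (Cons D Ds)
  \<comment> \<open>\<open>all_apart\<close> tests each pair in list order only, and it is not known
    which of \<open>B\<close> and \<open>C\<close> comes first.\<close>
  have "box_apart B C \<or> box_apart C B" if "B = D \<or> C = D"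
    using Cons.prems that by (auto simp: list_all_iff)
  then show ?case using Cons box_apart_disjoint[of B C s t u] box_apart_disjoint[of C B s t u] by auto
qed simp

text \<open>In every arrangement below the first four boxes touch pairwise, so a 5-colouring gives them
  four different colours. The predicates \<open>P\<close>, \<open>Q\<close>, \<open>R\<close>, \<open>S\<close> single out the boxes coloured like the
  first, second, third and fourth box, and \<open>T\<close> those with the remaining colour. Fixing the colours
  of a clique breaks the symmetry, which keeps the propositional refutations short.\<close>

definition not_both :: "(nat \<Rightarrow> bool) \<Rightarrow> nat \<Rightarrow> nat \<Rightarrow> bool" where
  "not_both P i j \<longleftrightarrow> \<not> P i \<or> \<not> P j"

definition differ where
  "differ P Q R S T i j \<longleftrightarrow>
     not_both P i j \<and> not_both Q i j \<and> not_both R i j \<and> not_both S i j \<and> not_both T i j"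

primrec pair_clauses where
  "pair_clauses P Q R S T i B j [] \<longleftrightarrow> True"
| "pair_clauses P Q R S T i B j (C # Cs) \<longleftrightarrow>
     (box_touch B C \<longrightarrow> differ P Q R S T i j) \<and> pair_clauses P Q R S T i B (j + 1) Cs"

text \<open>The counters number the boxes, so that once the geometry is evaluated only atoms such as
  \<open>P 7\<close> remain, which act as propositional variables.\<close>

primrec clauses where
  "clauses P Q R S T i [] \<longleftrightarrow> True"
| "clauses P Q R S T i (B # Bs) \<longleftrightarrow>
     (P i \<or> Q i \<or> R i \<or> S i \<or> T i) \<and> pair_clauses P Q R S T i B (i + 1) Bs \<and>
     clauses P Q R S T (i + 1) Bs"

lemma pair_clausesI:
  "(\<And>m. m < length Cs \<Longrightarrow> box_touch B (Cs ! m) \<Longrightarrow> differ P Q R S T i (j + m)) \<Longrightarrow>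
     pair_clauses P Q R S T i B j Cs"
proof (induction Cs arbitrary: j)
  case (Cons C Cs)
  have "pair_clauses P Q R S T i B (j + 1) Cs"
    using Cons.prems[of "Suc _"] by (intro Cons.IH) auto
  then show ?case using Cons.prems[of 0] by auto
qed simp

text \<open>The offset \<open>i\<close> is arbitrary because the recursion numbers the tail from
  \<open>i + 1\<close>; position \<open>m\<close> of the tail is position \<open>Suc m\<close> of
  the whole list.\<close>

lemma clausesI:
  assumes "\<And>m. m < length Bs \<Longrightarrow> P (i + m) \<or> Q (i + m) \<or> R (i + m) \<or> S (i + m) \<or> T (i + m)"
    and "\<And>m n. m < n \<Longrightarrow> n < length Bs \<Longrightarrow> box_touch (Bs ! m) (Bs ! n) \<Longrightarrow>
      differ P Q R S T (i + m) (i + n)"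
  shows "clauses P Q R S T i Bs"
  using assms
proof (induction Bs arbitrary: i)
  case (Cons B Bs)
  have "clauses P Q R S T (i + 1) Bs"
    using Cons.prems(1)[of "Suc _"] Cons.prems(2)[of "Suc _" "Suc _"] by (intro Cons.IH) auto
  moreover have "pair_clauses P Q R S T i B (i + 1) Bs"
    using Cons.prems(2)[of 0 "Suc _"] by (intro pair_clausesI) auto
  ultimately show ?case using Cons.prems(1)[of 0] by auto
qed simp

section \<open>From refuted clauses to the bound on \<open>chi3\<close>\<close>

fun starts_with_clique :: "box list \<Rightarrow> bool" where
  "starts_with_clique (A # B # C # D # Bs) \<longleftrightarrow>
     box_touch A B \<and> box_touch A C \<and> box_touch A D \<and> box_touch B C \<and> box_touch B D \<and> box_touch C D"
| "starts_with_clique _ \<longleftrightarrow> False"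

text \<open>Positivity makes the conversion by \<open>nat\<close> faithful and the boxes proper; the
  multiset equation is the permutation condition of \<open>CC3\<close>.\<close>

fun admissible :: "nat \<times> nat \<times> nat \<Rightarrow> nat multiset \<Rightarrow> point \<Rightarrow> bool" where
  "admissible (s, t, u) M (p, q, r) \<longleftrightarrow>
     0 < coord_val s p \<and> 0 < coord_val t q \<and> 0 < coord_val u r \<and>
     {#nat (coord_val s p), nat (coord_val t q), nat (coord_val u r)#} = M"

text \<open>All geometry ends here: a 5-colouring of the realized boxes, with its colours renamed
  after the clique, would be a model of the clauses. What remains for each arrangement is evaluation
  on literals and one propositional refutation.\<close>

lemma chi3_ge_6I:
  assumes apart: "all_apart (boxes gs)"
    and clique: "starts_with_clique (boxes gs)"
    and unsat: "\<And>P Q R S T. clauses P Q R S T 0 (boxes gs) \<Longrightarrow> P 0 \<Longrightarrow> Q 1 \<Longrightarrow> R 2 \<Longrightarrow> S 3 \<Longrightarrow> False"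
    and shape: "\<And>d. d \<in> fst ` set gs \<Longrightarrow> admissible (s, t, u) {#a, b, c#} d"
  shows "chi3 a b c \<ge> 6"
proof -
  let ?r = "realize s t u" and ?Bs = "boxes gs"
  obtain B0 B1 B2 B3 Bs where clique: "?Bs = B0 # B1 # B2 # B3 # Bs"
    "box_touch B0 B1" "box_touch B0 B2" "box_touch B0 B3"
    "box_touch B1 B2" "box_touch B1 B3" "box_touch B2 B3"
    using clique by (cases "?Bs" rule: starts_with_clique.cases) auto
  have box: "proper_box s t u B \<and> ?r B \<in> CC3 a b c" if "B \<in> set ?Bs" for B
  proof -
    have "set ?Bs = (\<Union>g\<in>set gs. cuboid (fst g) ` set (snd g))" by (induction gs) auto
    with that obtain g X where g: "g \<in> set gs" "B = cuboid (fst g) X" by auto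
    obtain p q r where pqr: "fst g = (p, q, r)" "0 < coord_val s p" "0 < coord_val t q" "0 < coord_val u r"
      "{#nat (coord_val s p), nat (coord_val t q), nat (coord_val u r)#} = {#a, b, c#}"
      using shape[OF imageI[OF g(1)]] by (cases "fst g" rule: prod_cases3) (simp del: coord_val.simps)
    obtain x y z where X: "X = (x, y, z)" by (cases X)
    \<comment> \<open>\<open>cuboid\<close> acts in the same way on every axis, so one axis is
      isolated and \<open>seg\<close> is proved only once.\<close>
    define sh :: "coord \<Rightarrow> coord \<Rightarrow> coord \<times> coord" where
      "sh = (\<lambda>p x. (x, (fst x + fst p, snd x + snd p)))"
    have B: "B = Box (sh p x) (sh q y) (sh r z)"
      unfolding g(2) pqr(1) X sh_def by (cases p; cases q; cases r; cases x; cases y; cases z) simp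
    have seg: "proper_seg w (sh p x)" "seg w (sh p x) =
        {of_int (coord_val w x) .. of_int (coord_val w x) + of_nat (nat (coord_val w p))}"
      if "0 < coord_val w p" for w p x
      using that by (cases p; cases x; simp add: sh_def proper_seg_def seg_def algebra_simps)+
    have "?r B \<in> CC1 (nat (coord_val s p)) (nat (coord_val t q)) (nat (coord_val u r))"
      unfolding B realize.simps seg(2)[OF pqr(2)] seg(2)[OF pqr(3)] seg(2)[OF pqr(4)] CC1_def by blast
    then have "?r B \<in> CC3 a b c" unfolding CC3_def using pqr(5) by blast
    then show ?thesis using seg(1) pqr by (simp add: B)
  qed
  have V: "configuration a b c (?r ` set ?Bs)"
    unfolding configuration_def
  proof (intro conjI ballI impI)
    show "?r ` set ?Bs \<subseteq> CC3 a b c" using box by blast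
    fix X Y assume "X \<in> ?r ` set ?Bs" "Y \<in> ?r ` set ?Bs" "X \<noteq> Y"
    then show "interior X \<inter> interior Y = {}" using all_apart_disjoint[OF apart] by blast
  qed simp
  have "\<not> proper_colouring (contact_graph (?r ` set ?Bs)) 5 f" for f
  proof
    assume f: "proper_colouring (contact_graph (?r ` set ?Bs)) 5 f"
    define h where "h = (\<lambda>i. f (?r (?Bs ! i)))"
    have less: "h i < 5" if "i < length ?Bs" for i
      using f nth_mem[OF that] unfolding proper_colouring_def contact_graph_def h_def by auto
    have diff: "h i \<noteq> h j" if "i < length ?Bs" "j < length ?Bs" "box_touch (?Bs ! i) (?Bs ! j)" for i j
    proof -
      have ij: "?Bs ! i \<in> set ?Bs" "?Bs ! j \<in> set ?Bs" using that by auto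
      with box_touch_touch[OF that(3), of s t u] box
      have "touch (?r (?Bs ! i)) (?r (?Bs ! j))" "?r (?Bs ! i) \<noteq> ?r (?Bs ! j)" by auto
      with ij have "{?r (?Bs ! i), ?r (?Bs ! j)} \<in> snd (contact_graph (?r ` set ?Bs))"
        unfolding contact_graph_def by auto
      with f show ?thesis unfolding proper_colouring_def h_def by auto
    qed
    have h: "h 0 \<noteq> h 1" "h 0 \<noteq> h 2" "h 0 \<noteq> h 3" "h 1 \<noteq> h 2" "h 1 \<noteq> h 3" "h 2 \<noteq> h 3"
      by (rule diff; simp add: clique)+
    \<comment> \<open>Five colours without the four distinct ones of the clique leave exactly one,
      \<open>e\<close>, whose class becomes \<open>T\<close>.\<close>
    let ?D = "{h 0, h 1, h 2, h 3}"
    have "card ?D = 4" using h by simp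
    moreover have "?D \<subseteq> {..<5}"
      using less[of 0] less[of 1] less[of 2] less[of 3] clique(1) by simp
    ultimately have "card ({..<5} - ?D) = 1" by (simp add: card_Diff_subset)
    then obtain e where e: "{..<5} - ?D = {e}" by (auto simp: card_1_singleton_iff)
    define T where "T = (\<lambda>i. h i = e)"
    have "clauses (\<lambda>i. h i = h 0) (\<lambda>i. h i = h 1) (\<lambda>i. h i = h 2) (\<lambda>i. h i = h 3) T 0 ?Bs"
    proof (rule clausesI)
      fix m assume "m < length ?Bs"
      then have "h m \<in> ?D \<or> h m \<in> {..<5} - ?D" using less by blast
      then show "h (0 + m) = h 0 \<or> h (0 + m) = h 1 \<or> h (0 + m) = h 2 \<or> h (0 + m) = h 3 \<or> T (0 + m)"
        unfolding T_def e by simp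
    next
      fix m n assume "m < n" "n < length ?Bs" "box_touch (?Bs ! m) (?Bs ! n)"
      then show "differ (\<lambda>i. h i = h 0) (\<lambda>i. h i = h 1) (\<lambda>i. h i = h 2) (\<lambda>i. h i = h 3) T (0 + m) (0 + n)"
        using diff[of m n] by (simp add: differ_def not_both_def T_def)
    qed
    \<comment> \<open>The fixed clique colours \<open>P 0\<close>, \<open>Q 1\<close>,
      \<open>R 2\<close>, \<open>S 3\<close> become reflexive equations.\<close>
    then show False by (rule unsat) simp_all
  qed
  then have "chi3 a b c \<ge> Suc 5" using V by (intro chi3_ge)
  then show ?thesis by simp
qed

section \<open>The seven arrangements\<close>

text \<open>A closed rule set for \<open>simp only\<close>: it decides every test on literal
  coordinates and leaves the colour atoms alone, which keeps evaluation manageable over thousands of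
  pairs of boxes.\<close>

lemmas boxes_eval =
  boxes.simps cuboid.simps list.map append.simps fst_conv snd_conv
  add_0 add_0_right arith_simps one_add_one numeral_plus_one one_plus_numeral
  apart.simps abut.simps overlap.simps box_apart.simps box_touch.simps
  coord_le.simps coord_less.simps prod.inject
  simp_thms rel_simps order_refl zero_neq_one one_neq_zero

section \<open>All sides at least 2\<close>

definition cubes :: "(point \<times> point list) list" where
  "cubes = [
    (((2, 1), (2, 1), (2, 1)),
      [((3, 1), (7, 3), (1, 0)), ((3, 1), (7, 3), (3, 1)), ((5, 2), (6, 3), (2, 1)),
       ((5, 2), (8, 4), (2, 1)), ((1, 0), (6, 3), (2, 1)), ((1, 0), (6, 3), (6, 3)),
       ((1, 0), (6, 3), (8, 4)), ((1, 0), (7, 3), (0, 0)), ((1, 0), (7, 3), (4, 2)),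
       ((1, 0), (7, 3), (10, 5)), ((1, 0), (8, 4), (2, 1)), ((1, 0), (8, 4), (6, 3)),
       ((1, 0), (8, 4), (8, 4)), ((1, 0), (10, 5), (8, 4)), ((2, 1), (5, 2), (0, 0)),
       ((2, 1), (5, 2), (4, 2)), ((2, 1), (5, 2), (10, 5)), ((2, 1), (9, 4), (0, 0)),
       ((2, 1), (9, 4), (4, 2)), ((2, 1), (9, 4), (10, 5)), ((3, 1), (5, 2), (2, 1)),
       ((3, 1), (5, 2), (6, 3)), ((3, 1), (5, 2), (8, 4)), ((3, 1), (7, 3), (5, 2)),
       ((3, 1), (7, 3), (7, 3)), ((3, 1), (7, 3), (9, 4)), ((3, 1), (7, 3), (11, 5)),
       ((3, 1), (9, 4), (2, 1)), ((3, 1), (9, 4), (6, 3)), ((3, 1), (9, 4), (8, 4)),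
       ((3, 1), (11, 5), (7, 3)), ((3, 1), (11, 5), (9, 4)), ((4, 2), (5, 2), (0, 0)),
       ((4, 2), (5, 2), (4, 2)), ((4, 2), (5, 2), (10, 5)), ((4, 2), (9, 4), (0, 0)),
       ((4, 2), (9, 4), (4, 2)), ((4, 2), (9, 4), (10, 5)), ((5, 2), (4, 2), (2, 1)),
       ((5, 2), (4, 2), (6, 3)), ((5, 2), (6, 3), (6, 3)), ((5, 2), (6, 3), (8, 4)),
       ((5, 2), (7, 3), (0, 0)), ((5, 2), (7, 3), (4, 2)), ((5, 2), (7, 3), (10, 5)),
       ((5, 2), (8, 4), (6, 3)), ((5, 2), (8, 4), (8, 4)), ((5, 2), (10, 5), (6, 3)),
       ((5, 2), (10, 5), (8, 4)), ((6, 3), (5, 2), (0, 0)), ((6, 3), (5, 2), (4, 2)),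
       ((6, 3), (5, 2), (10, 5)), ((6, 3), (9, 4), (0, 0)), ((6, 3), (9, 4), (4, 2)),
       ((6, 3), (9, 4), (10, 5)), ((7, 3), (5, 2), (2, 1)), ((7, 3), (5, 2), (6, 3)),
       ((7, 3), (5, 2), (8, 4)), ((7, 3), (7, 3), (1, 0)), ((7, 3), (7, 3), (3, 1)),
       ((7, 3), (7, 3), (5, 2)), ((7, 3), (7, 3), (7, 3)), ((7, 3), (7, 3), (9, 4)),
       ((7, 3), (7, 3), (11, 5)), ((7, 3), (9, 4), (2, 1)), ((7, 3), (9, 4), (6, 3)),
       ((7, 3), (9, 4), (8, 4)), ((7, 3), (11, 5), (5, 2)), ((7, 3), (11, 5), (7, 3)),
       ((8, 4), (5, 2), (0, 0)), ((8, 4), (5, 2), (4, 2)), ((8, 4), (5, 2), (10, 5)),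
       ((8, 4), (9, 4), (0, 0)), ((8, 4), (9, 4), (4, 2)), ((8, 4), (9, 4), (10, 5)),
       ((9, 4), (6, 3), (2, 1)), ((9, 4), (6, 3), (6, 3)), ((9, 4), (6, 3), (8, 4)),
       ((9, 4), (7, 3), (0, 0)), ((9, 4), (7, 3), (4, 2)), ((9, 4), (7, 3), (10, 5)),
       ((9, 4), (8, 4), (2, 1)), ((9, 4), (8, 4), (6, 3)), ((9, 4), (8, 4), (8, 4)),
       ((9, 4), (10, 5), (6, 3))])]"

lemma cubes_apart: "all_apart (boxes cubes)"
  by (simp only: cubes_def boxes_eval all_apart.simps list.pred_inject)

lemma cubes_clique: "starts_with_clique (boxes cubes)"
  by (simp only: cubes_def boxes_eval starts_with_clique.simps)

\<comment> \<open>The simplifier instantiates \<open>?C\<close> with the explicit clause set: tests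
  on non-touching pairs vanish, and the large formula never has to be written out.\<close>
schematic_goal cubes_clauses: "clauses P Q R S T 0 (boxes cubes) = ?C"
  by (simp only: cubes_def boxes_eval clauses.simps pair_clauses.simps differ_def not_both_def)

lemma cubes_unsat:
  "clauses P Q R S T 0 (boxes cubes) \<Longrightarrow> P 0 \<Longrightarrow> Q 1 \<Longrightarrow> R 2 \<Longrightarrow> S 3 \<Longrightarrow> False"
  unfolding cubes_clauses by sat

text \<open>All boxes have the same orientation, so each axis can be stretched by its own amount and
  a 2 by 2 by 2 arrangement serves every larger cuboid.\<close>

lemma chi3_cubes:
  assumes "c \<ge> 2" "b \<ge> 2" "a \<ge> 2"
  shows "chi3 a b c \<ge> 6"
proof (rule chi3_ge_6I[OF cubes_apart cubes_clique cubes_unsat])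
  have "fst ` set cubes = {((2, 1), (2, 1), (2, 1))}"
    by (auto simp only: cubes_def list.set image_insert image_empty fst_conv)
  \<comment> \<open>The parameters are the excesses over the minimal side 2; the assumptions keep
    the natural subtraction exact.\<close>
  then show "admissible (a - 2, b - 2, c - 2) {#a, b, c#} d" if "d \<in> fst ` set cubes" for d
    using that assms by (auto simp: of_nat_diff)
qed

section \<open>The single triple \<open>(2, 2, 1)\<close>\<close>

definition slabs :: "(point \<times> point list) list" where
  "slabs = [
    (((2, 0), (1, 0), (2, 0)),
      [((1, 0), (3, 0), (4, 0))]),
    (((1, 0), (2, 0), (2, 0)),
      [((1, 0), (1, 0), (5, 0)), ((2, 0), (2, 0), (6, 0))]),
    (((2, 0), (2, 0), (1, 0)),
      [((2, 0), (1, 0), (5, 0)), ((1, 0), (1, 0), (9, 0)), ((2, 0), (1, 0), (8, 0)),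
       ((2, 0), (3, 0), (3, 0)), ((2, 0), (4, 0), (4, 0)), ((3, 0), (0, 0), (4, 0)),
       ((3, 0), (0, 0), (9, 0)), ((3, 0), (1, 0), (6, 0)), ((3, 0), (1, 0), (7, 0)),
       ((3, 0), (2, 0), (4, 0)), ((3, 0), (2, 0), (9, 0)), ((3, 0), (3, 0), (5, 0)),
       ((3, 0), (3, 0), (6, 0)), ((4, 0), (1, 0), (3, 0)), ((4, 0), (1, 0), (5, 0)),
       ((4, 0), (1, 0), (8, 0)), ((4, 0), (4, 0), (7, 0)), ((5, 0), (1, 0), (4, 0)),
       ((5, 0), (1, 0), (9, 0)), ((6, 0), (0, 0), (3, 0)), ((6, 0), (2, 0), (3, 0)),
       ((6, 0), (3, 0), (6, 0)), ((6, 0), (3, 0), (7, 0)), ((6, 0), (4, 0), (5, 0))]),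
    (((2, 0), (1, 0), (2, 0)),
      [((0, 0), (0, 0), (2, 0)), ((0, 0), (0, 0), (6, 0)), ((0, 0), (3, 0), (2, 0)),
       ((0, 0), (3, 0), (6, 0)), ((1, 0), (0, 0), (4, 0)), ((1, 0), (0, 0), (8, 0)),
       ((1, 0), (1, 0), (3, 0)), ((1, 0), (2, 0), (3, 0)), ((1, 0), (3, 0), (8, 0)),
       ((1, 0), (4, 0), (5, 0)), ((2, 0), (0, 0), (2, 0)), ((2, 0), (4, 0), (7, 0)),
       ((3, 0), (0, 0), (5, 0)), ((3, 0), (0, 0), (7, 0)), ((3, 0), (3, 0), (7, 0)),
       ((4, 0), (0, 0), (2, 0)), ((4, 0), (3, 0), (2, 0)), ((5, 0), (0, 0), (4, 0)),
       ((5, 0), (0, 0), (8, 0)), ((5, 0), (3, 0), (4, 0)), ((5, 0), (3, 0), (8, 0)),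
       ((5, 0), (4, 0), (3, 0))]),
    (((1, 0), (2, 0), (2, 0)),
      [((0, 0), (0, 0), (4, 0)), ((0, 0), (0, 0), (8, 0)), ((0, 0), (1, 0), (2, 0)),
       ((0, 0), (1, 0), (6, 0)), ((0, 0), (2, 0), (4, 0)), ((0, 0), (2, 0), (8, 0)),
       ((1, 0), (1, 0), (1, 0)), ((1, 0), (1, 0), (7, 0)), ((2, 0), (0, 0), (6, 0)),
       ((2, 0), (1, 0), (1, 0)), ((3, 0), (1, 0), (2, 0)), ((5, 0), (0, 0), (6, 0)),
       ((5, 0), (2, 0), (6, 0)), ((5, 0), (4, 0), (5, 0)), ((6, 0), (1, 0), (5, 0)),
       ((6, 0), (1, 0), (7, 0)), ((6, 0), (5, 0), (6, 0)), ((7, 0), (0, 0), (4, 0)),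
       ((7, 0), (1, 0), (6, 0)), ((7, 0), (2, 0), (4, 0)), ((7, 0), (2, 0), (8, 0))])]"

lemma slabs_apart: "all_apart (boxes slabs)"
  by (simp only: slabs_def boxes_eval all_apart.simps list.pred_inject)

text \<open>The four clique boxes lead the list, which is why some shapes occur in two groups of
  \<open>slabs\<close>.\<close>

lemma slabs_clique: "starts_with_clique (boxes slabs)"
  by (simp only: slabs_def boxes_eval starts_with_clique.simps)

schematic_goal slabs_clauses: "clauses P Q R S T 0 (boxes slabs) = ?C"
  by (simp only: slabs_def boxes_eval clauses.simps pair_clauses.simps differ_def not_both_def)

lemma slabs_unsat:
  "clauses P Q R S T 0 (boxes slabs) \<Longrightarrow> P 0 \<Longrightarrow> Q 1 \<Longrightarrow> R 2 \<Longrightarrow> S 3 \<Longrightarrow> False"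
  unfolding slabs_clauses by sat

lemma chi3_slabs:
  "chi3 2 2 1 \<ge> 6"
proof (rule chi3_ge_6I[OF slabs_apart slabs_clique slabs_unsat])
  have "fst ` set slabs = {((2, 0), (1, 0), (2, 0)), ((1, 0), (2, 0), (2, 0)), ((2, 0), (2, 0), (1, 0))}"
    by (auto simp only: slabs_def list.set image_insert image_empty fst_conv)
  \<comment> \<open>Every coordinate has second component 0, so the arrangement has a fixed size and
    the parameters are set to 0.\<close>
  then show "admissible (0, 0, 0) {#2, 2, 1#} d" if "d \<in> fst ` set slabs" for d
    using that by (auto simp: of_nat_diff)
qed

section \<open>One side 1, the others at least 2 and at least 3\<close>

definition planks :: "(point \<times> point list) list" where
  "planks = [
    (((3, 1), (2, 1), (1, 0)),
      [((4, 1), (5, 2), (6, 2))]),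
    (((1, 0), (2, 1), (3, 1)),
      [((5, 2), (6, 3), (3, 1)), ((6, 2), (5, 2), (3, 1)), ((6, 2), (7, 3), (4, 1)),
       ((2, 1), (7, 3), (4, 1)), ((3, 1), (5, 2), (0, 0)), ((3, 1), (6, 3), (3, 1)),
       ((4, 2), (2, 1), (3, 1)), ((4, 2), (6, 3), (3, 1)), ((5, 2), (2, 1), (3, 1)),
       ((6, 2), (1, 0), (3, 1)), ((6, 2), (3, 1), (1, 0)), ((6, 2), (3, 1), (4, 1)),
       ((6, 2), (7, 3), (1, 0)), ((6, 2), (9, 4), (3, 1)), ((7, 2), (2, 1), (2, 0)),
       ((7, 2), (2, 1), (5, 1)), ((7, 2), (4, 2), (2, 0)), ((7, 2), (4, 2), (5, 1)),
       ((7, 2), (6, 3), (1, 0)), ((7, 2), (6, 3), (4, 1)), ((7, 2), (8, 4), (2, 0)),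
       ((7, 2), (8, 4), (5, 1))]),
    (((3, 1), (2, 1), (1, 0)),
      [((1, 0), (5, 2), (6, 2)), ((2, 0), (6, 3), (7, 2)), ((3, 1), (3, 1), (2, 1)),
       ((3, 1), (3, 1), (6, 2)), ((3, 1), (4, 2), (3, 1)), ((3, 1), (4, 2), (4, 1)),
       ((3, 1), (4, 2), (5, 2)), ((3, 1), (7, 3), (2, 1)), ((3, 1), (7, 3), (6, 2)),
       ((3, 1), (8, 4), (3, 1)), ((3, 1), (8, 4), (4, 2)), ((3, 1), (8, 4), (5, 2)),
       ((4, 1), (1, 0), (6, 2)), ((4, 1), (4, 2), (7, 2)), ((4, 1), (5, 2), (2, 1)),
       ((4, 1), (9, 4), (2, 1)), ((4, 1), (9, 4), (6, 2)), ((5, 1), (6, 3), (7, 2))])]"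

lemma planks_apart: "all_apart (boxes planks)"
  by (simp only: planks_def boxes_eval all_apart.simps list.pred_inject)

lemma planks_clique: "starts_with_clique (boxes planks)"
  by (simp only: planks_def boxes_eval starts_with_clique.simps)

schematic_goal planks_clauses: "clauses P Q R S T 0 (boxes planks) = ?C"
  by (simp only: planks_def boxes_eval clauses.simps pair_clauses.simps differ_def not_both_def)

lemma planks_unsat:
  "clauses P Q R S T 0 (boxes planks) \<Longrightarrow> P 0 \<Longrightarrow> Q 1 \<Longrightarrow> R 2 \<Longrightarrow> S 3 \<Longrightarrow> False"
  unfolding planks_clauses by sat

lemma chi3_planks:
  assumes "a \<ge> 3" "b \<ge> 2"
  shows "chi3 a b 1 \<ge> 6"
proof (rule chi3_ge_6I[OF planks_apart planks_clique planks_unsat])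
  have "fst ` set planks = {((3, 1), (2, 1), (1, 0)), ((1, 0), (2, 1), (3, 1))}"
    by (auto simp only: planks_def list.set image_insert image_empty fst_conv)
  \<comment> \<open>The side \<open>b\<close> always lies along the second axis, while
    \<open>a\<close> lies along the first or the third; hence \<open>a - 3\<close> occurs twice and
    \<open>a\<close> and \<open>b\<close> vary independently.\<close>
  then show "admissible (a - 3, b - 2, a - 3) {#a, b, 1#} d" if "d \<in> fst ` set planks" for d
    using that assms by (auto simp: of_nat_diff)
qed

section \<open>Rods of length 4, 5 and 6\<close>

definition rods4 :: "(point \<times> point list) list" where
  "rods4 = [
    (((1, 0), (4, 0), (1, 0)),
      [((4, 0), (5, 0), (3, 0))]),
    (((4, 0), (1, 0), (1, 0)),
      [((1, 0), (7, 0), (2, 0)), ((4, 0), (6, 0), (2, 0))]),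
    (((1, 0), (1, 0), (4, 0)),
      [((3, 0), (6, 0), (0, 0)), ((1, 0), (4, 0), (1, 0)), ((1, 0), (5, 0), (0, 0)),
       ((1, 0), (6, 0), (0, 0)), ((2, 0), (2, 0), (0, 0)), ((2, 0), (5, 0), (4, 0)),
       ((2, 0), (7, 0), (3, 0)), ((2, 0), (8, 0), (0, 0)), ((3, 0), (2, 0), (2, 0)),
       ((3, 0), (3, 0), (3, 0)), ((3, 0), (4, 0), (1, 0)), ((3, 0), (5, 0), (3, 0)),
       ((3, 0), (7, 0), (3, 0)), ((3, 0), (8, 0), (0, 0)), ((4, 0), (3, 0), (5, 0)),
       ((4, 0), (4, 0), (0, 0)), ((4, 0), (5, 0), (5, 0)), ((4, 0), (7, 0), (4, 0)),
       ((5, 0), (1, 0), (0, 0)), ((5, 0), (3, 0), (5, 0)), ((5, 0), (5, 0), (4, 0)),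
       ((5, 0), (7, 0), (2, 0)), ((6, 0), (1, 0), (2, 0)), ((6, 0), (5, 0), (6, 0)),
       ((6, 0), (7, 0), (2, 0)), ((7, 0), (1, 0), (1, 0)), ((7, 0), (3, 0), (4, 0)),
       ((7, 0), (4, 0), (3, 0)), ((7, 0), (5, 0), (2, 0)), ((7, 0), (6, 0), (3, 0)),
       ((7, 0), (7, 0), (2, 0)), ((8, 0), (9, 0), (1, 0)), ((9, 0), (5, 0), (1, 0)),
       ((9, 0), (6, 0), (0, 0))]),
    (((1, 0), (4, 0), (1, 0)),
      [((0, 0), (3, 0), (1, 0)), ((0, 0), (4, 0), (2, 0)), ((0, 0), (5, 0), (0, 0)),
       ((2, 0), (1, 0), (4, 0)), ((2, 0), (3, 0), (1, 0)), ((2, 0), (3, 0), (2, 0)),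
       ((2, 0), (3, 0), (3, 0)), ((3, 0), (0, 0), (1, 0)), ((3, 0), (4, 0), (7, 0)),
       ((4, 0), (0, 0), (1, 0)), ((4, 0), (0, 0), (3, 0)), ((4, 0), (2, 0), (4, 0)),
       ((4, 0), (5, 0), (1, 0)), ((5, 0), (1, 0), (4, 0)), ((5, 0), (2, 0), (1, 0)),
       ((5, 0), (3, 0), (3, 0)), ((5, 0), (5, 0), (8, 0)), ((5, 0), (6, 0), (1, 0)),
       ((6, 0), (1, 0), (1, 0)), ((6, 0), (3, 0), (3, 0)), ((6, 0), (3, 0), (4, 0)),
       ((6, 0), (3, 0), (5, 0)), ((6, 0), (5, 0), (1, 0)), ((7, 0), (2, 0), (1, 0)),
       ((7, 0), (6, 0), (1, 0)), ((8, 0), (4, 0), (3, 0)), ((8, 0), (4, 0), (4, 0)),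
       ((8, 0), (5, 0), (1, 0)), ((8, 0), (5, 0), (2, 0)), ((8, 0), (6, 0), (5, 0))]),
    (((4, 0), (1, 0), (1, 0)),
      [((0, 0), (4, 0), (0, 0)), ((0, 0), (7, 0), (1, 0)), ((1, 0), (1, 0), (2, 0)),
       ((1, 0), (4, 0), (5, 0)), ((1, 0), (8, 0), (4, 0)), ((2, 0), (3, 0), (0, 0)),
       ((2, 0), (5, 0), (0, 0)), ((2, 0), (6, 0), (4, 0)), ((2, 0), (6, 0), (5, 0)),
       ((2, 0), (7, 0), (0, 0)), ((3, 0), (2, 0), (0, 0)), ((3, 0), (3, 0), (2, 0)),
       ((3, 0), (4, 0), (6, 0)), ((3, 0), (5, 0), (2, 0)), ((3, 0), (6, 0), (6, 0)),
       ((4, 0), (2, 0), (2, 0)), ((4, 0), (2, 0), (5, 0)), ((4, 0), (4, 0), (7, 0)),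
       ((4, 0), (4, 0), (8, 0)), ((4, 0), (6, 0), (7, 0)), ((4, 0), (8, 0), (0, 0)),
       ((4, 0), (8, 0), (2, 0)), ((4, 0), (8, 0), (5, 0)), ((5, 0), (2, 0), (3, 0)),
       ((5, 0), (4, 0), (0, 0)), ((5, 0), (4, 0), (2, 0)), ((5, 0), (6, 0), (0, 0)),
       ((5, 0), (7, 0), (6, 0)), ((5, 0), (8, 0), (3, 0)), ((5, 0), (8, 0), (4, 0)),
       ((6, 0), (2, 0), (4, 0)), ((6, 0), (3, 0), (0, 0)), ((6, 0), (5, 0), (0, 0))])]"

lemma rods4_apart: "all_apart (boxes rods4)"
  by (simp only: rods4_def boxes_eval all_apart.simps list.pred_inject)

lemma rods4_clique: "starts_with_clique (boxes rods4)"
  by (simp only: rods4_def boxes_eval starts_with_clique.simps)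

schematic_goal rods4_clauses: "clauses P Q R S T 0 (boxes rods4) = ?C"
  by (simp only: rods4_def boxes_eval clauses.simps pair_clauses.simps differ_def not_both_def)

lemma rods4_unsat:
  "clauses P Q R S T 0 (boxes rods4) \<Longrightarrow> P 0 \<Longrightarrow> Q 1 \<Longrightarrow> R 2 \<Longrightarrow> S 3 \<Longrightarrow> False"
  unfolding rods4_clauses by sat

text \<open>The parametric arrangement of rods starts at length 7, so lengths 4, 5 and 6 get fixed
  arrangements of their own.\<close>

lemma chi3_rods4:
  "chi3 4 1 1 \<ge> 6"
proof (rule chi3_ge_6I[OF rods4_apart rods4_clique rods4_unsat])
  have "fst ` set rods4 = {((1, 0), (4, 0), (1, 0)), ((4, 0), (1, 0), (1, 0)), ((1, 0), (1, 0), (4, 0))}"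
    by (auto simp only: rods4_def list.set image_insert image_empty fst_conv)
  then show "admissible (0, 0, 0) {#4, 1, 1#} d" if "d \<in> fst ` set rods4" for d
    using that by (auto simp: of_nat_diff)
qed

definition rods5 :: "(point \<times> point list) list" where
  "rods5 = [
    (((5, 0), (1, 0), (1, 0)),
      [((3, 0), (8, 0), (7, 0))]),
    (((1, 0), (1, 0), (5, 0)),
      [((4, 0), (7, 0), (4, 0)), ((5, 0), (7, 0), (3, 0))]),
    (((1, 0), (5, 0), (1, 0)),
      [((5, 0), (6, 0), (8, 0)), ((2, 0), (5, 0), (8, 0)), ((2, 0), (6, 0), (5, 0)),
       ((2, 0), (6, 0), (6, 0)), ((2, 0), (6, 0), (7, 0)), ((3, 0), (5, 0), (8, 0)),
       ((4, 0), (2, 0), (5, 0)), ((4, 0), (2, 0), (8, 0)), ((4, 0), (5, 0), (3, 0)),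
       ((6, 0), (3, 0), (5, 0)), ((6, 0), (6, 0), (4, 0))]),
    (((5, 0), (1, 0), (1, 0)),
      [((0, 0), (5, 0), (6, 0)), ((0, 0), (5, 0), (7, 0)), ((0, 0), (6, 0), (4, 0)),
       ((1, 0), (7, 0), (9, 0)), ((1, 0), (8, 0), (4, 0)), ((1, 0), (9, 0), (9, 0)),
       ((1, 0), (10, 0), (4, 0)), ((2, 0), (6, 0), (9, 0)), ((2, 0), (8, 0), (9, 0)),
       ((3, 0), (5, 0), (4, 0)), ((3, 0), (6, 0), (6, 0)), ((3, 0), (6, 0), (7, 0)),
       ((4, 0), (8, 0), (5, 0)), ((5, 0), (8, 0), (6, 0)), ((6, 0), (8, 0), (8, 0))]),
    (((1, 0), (1, 0), (5, 0)),
      [((1, 0), (6, 0), (5, 0)), ((1, 0), (7, 0), (4, 0)), ((1, 0), (9, 0), (4, 0)),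
       ((1, 0), (10, 0), (5, 0)), ((3, 0), (7, 0), (3, 0)), ((5, 0), (5, 0), (5, 0)),
       ((5, 0), (6, 0), (1, 0)), ((5, 0), (9, 0), (3, 0)), ((6, 0), (7, 0), (6, 0)),
       ((6, 0), (9, 0), (5, 0)), ((7, 0), (9, 0), (5, 0))])]"

lemma rods5_apart: "all_apart (boxes rods5)"
  by (simp only: rods5_def boxes_eval all_apart.simps list.pred_inject)

lemma rods5_clique: "starts_with_clique (boxes rods5)"
  by (simp only: rods5_def boxes_eval starts_with_clique.simps)

schematic_goal rods5_clauses: "clauses P Q R S T 0 (boxes rods5) = ?C"
  by (simp only: rods5_def boxes_eval clauses.simps pair_clauses.simps differ_def not_both_def)

lemma rods5_unsat:
  "clauses P Q R S T 0 (boxes rods5) \<Longrightarrow> P 0 \<Longrightarrow> Q 1 \<Longrightarrow> R 2 \<Longrightarrow> S 3 \<Longrightarrow> False"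
  unfolding rods5_clauses by sat

lemma chi3_rods5:
  "chi3 5 1 1 \<ge> 6"
proof (rule chi3_ge_6I[OF rods5_apart rods5_clique rods5_unsat])
  have "fst ` set rods5 = {((5, 0), (1, 0), (1, 0)), ((1, 0), (1, 0), (5, 0)), ((1, 0), (5, 0), (1, 0))}"
    by (auto simp only: rods5_def list.set image_insert image_empty fst_conv)
  then show "admissible (0, 0, 0) {#5, 1, 1#} d" if "d \<in> fst ` set rods5" for d
    using that by (auto simp: of_nat_diff)
qed

definition rods6 :: "(point \<times> point list) list" where
  "rods6 = [
    (((6, 0), (1, 0), (1, 0)),
      [((2, 0), (8, 0), (8, 0)), ((6, 0), (9, 0), (8, 0))]),
    (((1, 0), (6, 0), (1, 0)),
      [((6, 0), (5, 0), (9, 0)), ((7, 0), (4, 0), (9, 0)), ((4, 0), (5, 0), (9, 0)),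
       ((4, 0), (6, 0), (6, 0)), ((4, 0), (6, 0), (7, 0)), ((5, 0), (4, 0), (9, 0)),
       ((8, 0), (1, 0), (6, 0)), ((8, 0), (1, 0), (7, 0)), ((8, 0), (2, 0), (9, 0)),
       ((9, 0), (6, 0), (9, 0)), ((10, 0), (3, 0), (2, 0)), ((10, 0), (6, 0), (9, 0))]),
    (((6, 0), (1, 0), (1, 0)),
      [((0, 0), (9, 0), (10, 0)), ((2, 0), (5, 0), (6, 0)), ((2, 0), (5, 0), (7, 0)),
       ((2, 0), (8, 0), (10, 0)), ((3, 0), (5, 0), (5, 0)), ((3, 0), (5, 0), (8, 0)),
       ((4, 0), (7, 0), (2, 0)), ((4, 0), (7, 0), (8, 0)), ((4, 0), (10, 0), (10, 0)),
       ((4, 0), (11, 0), (5, 0)), ((5, 0), (6, 0), (8, 0)), ((5, 0), (6, 0), (10, 0)),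
       ((5, 0), (7, 0), (3, 0)), ((5, 0), (7, 0), (6, 0)), ((5, 0), (7, 0), (7, 0)),
       ((5, 0), (7, 0), (10, 0)), ((5, 0), (11, 0), (6, 0)), ((6, 0), (9, 0), (4, 0)),
       ((6, 0), (9, 0), (5, 0)), ((6, 0), (9, 0), (6, 0)), ((6, 0), (9, 0), (7, 0)),
       ((6, 0), (9, 0), (10, 0))]),
    (((1, 0), (1, 0), (6, 0)),
      [((3, 0), (6, 0), (5, 0)), ((3, 0), (7, 0), (5, 0)), ((5, 0), (6, 0), (2, 0)),
       ((5, 0), (8, 0), (1, 0)), ((5, 0), (9, 0), (3, 0)), ((5, 0), (10, 0), (4, 0)),
       ((6, 0), (4, 0), (4, 0)), ((6, 0), (6, 0), (2, 0)), ((6, 0), (8, 0), (2, 0)),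
       ((6, 0), (10, 0), (3, 0)), ((7, 0), (4, 0), (3, 0)), ((7, 0), (8, 0), (2, 0)),
       ((7, 0), (10, 0), (4, 0)), ((8, 0), (8, 0), (0, 0)), ((8, 0), (8, 0), (6, 0)),
       ((8, 0), (10, 0), (4, 0)), ((9, 0), (5, 0), (5, 0)), ((9, 0), (6, 0), (2, 0)),
       ((9, 0), (8, 0), (2, 0)), ((9, 0), (10, 0), (3, 0)), ((10, 0), (8, 0), (3, 0)),
       ((11, 0), (7, 0), (5, 0)), ((11, 0), (8, 0), (0, 0)), ((11, 0), (8, 0), (6, 0))])]"

lemma rods6_apart: "all_apart (boxes rods6)"
  by (simp only: rods6_def boxes_eval all_apart.simps list.pred_inject)

lemma rods6_clique: "starts_with_clique (boxes rods6)"
  by (simp only: rods6_def boxes_eval starts_with_clique.simps)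

schematic_goal rods6_clauses: "clauses P Q R S T 0 (boxes rods6) = ?C"
  by (simp only: rods6_def boxes_eval clauses.simps pair_clauses.simps differ_def not_both_def)

lemma rods6_unsat:
  "clauses P Q R S T 0 (boxes rods6) \<Longrightarrow> P 0 \<Longrightarrow> Q 1 \<Longrightarrow> R 2 \<Longrightarrow> S 3 \<Longrightarrow> False"
  unfolding rods6_clauses by sat

lemma chi3_rods6:
  "chi3 6 1 1 \<ge> 6"
proof (rule chi3_ge_6I[OF rods6_apart rods6_clique rods6_unsat])
  have "fst ` set rods6 = {((6, 0), (1, 0), (1, 0)), ((1, 0), (6, 0), (1, 0)), ((1, 0), (1, 0), (6, 0))}"
    by (auto simp only: rods6_def list.set image_insert image_empty fst_conv)
  then show "admissible (0, 0, 0) {#6, 1, 1#} d" if "d \<in> fst ` set rods6" for d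
    using that by (auto simp: of_nat_diff)
qed

section \<open>Rods of length at least 7\<close>

definition rods :: "(point \<times> point list) list" where
  "rods = [
    (((7, 1), (1, 0), (1, 0)),
      [((10, 1), (12, 1), (11, 1))]),
    (((1, 0), (1, 0), (7, 1)),
      [((10, 1), (11, 1), (7, 0))]),
    (((1, 0), (7, 1), (1, 0)),
      [((11, 1), (5, 0), (11, 1)), ((11, 1), (9, 1), (12, 1)), ((9, 1), (3, 0), (12, 1)),
       ((9, 1), (6, 0), (13, 1)), ((9, 1), (7, 0), (11, 1)), ((9, 1), (13, 1), (12, 1)),
       ((10, 1), (12, 1), (12, 1)), ((11, 1), (3, 0), (13, 1)), ((11, 1), (8, 0), (10, 1)),
       ((11, 1), (12, 1), (14, 1)), ((12, 1), (12, 1), (12, 1)), ((12, 1), (14, 1), (14, 1)),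
       ((13, 1), (3, 0), (11, 1)), ((13, 1), (3, 0), (12, 1)), ((13, 1), (4, 0), (8, 1)),
       ((13, 1), (4, 0), (9, 1)), ((13, 1), (4, 0), (10, 1)), ((13, 1), (12, 1), (12, 1)),
       ((13, 1), (13, 1), (14, 1)), ((14, 1), (10, 1), (10, 1)), ((14, 1), (11, 1), (12, 1)),
       ((15, 1), (6, 0), (10, 1)), ((15, 1), (11, 1), (12, 1))]),
    (((7, 1), (1, 0), (1, 0)),
      [((2, 0), (12, 1), (11, 1)), ((3, 0), (10, 1), (9, 1)), ((3, 0), (10, 1), (10, 1)),
       ((3, 0), (10, 1), (12, 1)), ((3, 0), (12, 1), (12, 1)), ((4, 0), (9, 1), (10, 1)),
       ((4, 0), (12, 1), (10, 1)), ((5, 0), (13, 1), (13, 1)), ((6, 0), (9, 1), (8, 1)),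
       ((6, 0), (9, 1), (9, 1)), ((7, 0), (12, 1), (9, 1)), ((7, 0), (14, 1), (11, 1)),
       ((7, 0), (15, 1), (13, 1)), ((9, 1), (14, 1), (13, 1)), ((10, 1), (9, 1), (7, 1)),
       ((10, 1), (10, 1), (13, 1)), ((10, 1), (13, 1), (11, 1)), ((11, 1), (12, 1), (13, 1)),
       ((12, 1), (8, 1), (13, 1)), ((12, 1), (10, 1), (11, 1)), ((12, 1), (10, 1), (12, 1)),
       ((12, 1), (12, 1), (14, 1)), ((13, 1), (13, 1), (13, 1)), ((14, 1), (11, 1), (11, 1)),
       ((14, 1), (14, 1), (11, 1))]),
    (((1, 0), (1, 0), (7, 1)),
      [((7, 1), (13, 1), (6, 0)), ((8, 1), (11, 1), (7, 0)), ((8, 1), (13, 1), (6, 0)),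
       ((9, 1), (11, 1), (4, 0)), ((10, 1), (8, 1), (7, 0)), ((10, 1), (9, 1), (11, 1)),
       ((10, 1), (10, 1), (6, 0)), ((10, 1), (12, 1), (13, 1)), ((11, 1), (11, 1), (13, 1)),
       ((12, 1), (8, 1), (6, 0)), ((12, 1), (9, 1), (10, 1)), ((12, 1), (10, 1), (4, 0)),
       ((12, 1), (11, 1), (8, 1)), ((12, 1), (13, 1), (13, 1)), ((13, 1), (11, 1), (9, 1)),
       ((14, 1), (9, 1), (8, 1)), ((15, 1), (9, 1), (11, 1))])]"

lemma rods_apart: "all_apart (boxes rods)"
  by (simp only: rods_def boxes_eval all_apart.simps list.pred_inject)

lemma rods_clique: "starts_with_clique (boxes rods)"
  by (simp only: rods_def boxes_eval starts_with_clique.simps)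

schematic_goal rods_clauses: "clauses P Q R S T 0 (boxes rods) = ?C"
  by (simp only: rods_def boxes_eval clauses.simps pair_clauses.simps differ_def not_both_def)

lemma rods_unsat:
  "clauses P Q R S T 0 (boxes rods) \<Longrightarrow> P 0 \<Longrightarrow> Q 1 \<Longrightarrow> R 2 \<Longrightarrow> S 3 \<Longrightarrow> False"
  unfolding rods_clauses by sat

lemma chi3_rods:
  assumes "a \<ge> 7"
  shows "chi3 a 1 1 \<ge> 6"
proof (rule chi3_ge_6I[OF rods_apart rods_clique rods_unsat])
  have "fst ` set rods = {((7, 1), (1, 0), (1, 0)), ((1, 0), (1, 0), (7, 1)), ((1, 0), (7, 1), (1, 0))}"
    by (auto simp only: rods_def list.set image_insert image_empty fst_conv)
  \<comment> \<open>Rods occur in all three directions, so every axis carries the long side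
    somewhere and all axes must share the same excess.\<close>
  then show "admissible (a - 7, a - 7, a - 7) {#a, 1, 1#} d" if "d \<in> fst ` set rods" for d
    using that assms by (auto simp: of_nat_diff)
qed

section \<open>All side lengths\<close>

theorem theorem5p1:
  fixes a b c :: nat
  assumes "a \<ge> b" and "b \<ge> c" and "c > 0"
    and "(a, b, c) \<notin> {(1, 1, 1), (2, 1, 1), (3, 1, 1)}"
  shows "chi3 a b c \<ge> 6"
proof -
  \<comment> \<open>With \<open>c = 1\<close> and \<open>b\<close> at least 2,
    \<open>a \<ge> b\<close> leaves only \<open>(2, 2, 1)\<close> outside the range of the planks.
    With \<open>b = 1\<close> also \<open>c = 1\<close>, and the excluded triples leave
    \<open>a \<ge> 4\<close>.\<close>
  consider "c \<ge> 2" | "c = 1" "b \<ge> 2" "a \<ge> 3" | "a = 2" "b = 2" "c = 1"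
    | "b = 1" "c = 1" "a \<ge> 4"
    using assms by (cases "a = 1"; cases "a = 2"; cases "a = 3"; cases "b = 1"; auto; linarith)
  then show ?thesis
  proof cases
    case 1
    then show ?thesis using assms by (intro chi3_cubes) auto
  next
    case 2
    then show ?thesis using chi3_planks by simp
  next
    case 3
    then show ?thesis using chi3_slabs by simp
  next
    case 4
    then consider "a = 4" | "a = 5" | "a = 6" | "a \<ge> 7" by linarith
    then show ?thesis
      using 4 chi3_rods4 chi3_rods5 chi3_rods6 chi3_rods[of a] by cases auto
  qed
qed

end
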